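(* Suppose that $\varphi:\mathbb{D}\to\mathbb{D}$ is holomorphic and that there is an integer $N\in\mathbb{N}$ such that $$m\bigl(\mathbb{D}\setminus\{z\in\mathbb{D}:\ \#\,\varphi^{-1}(\{z\})=N\}\bigr)=0,$$ where $m$ is normalized area measure on $\mathbb{D}$. Then, for each constant $c$ with $|c|=1$, the weight $w=c\varphi'/\sqrt{N}$ induces an isometric weighted composition operator $T_{w,\varphi}$ on the Bergman space $A^2$.
   Context: $\mathbb{D}$ is the open unit disc and $\#$ denotes cardinality. $A^2$ is the Bergman space of holomorphic functions $f$ on $\mathbb{D}$ with $\|f\|_{A^2}^2=\int_{\mathbb{D}}|f|^2\,dm<\infty$. The weighted composition operator is $(T_{w,\varphi}f)(z)=w(z)f(\varphi(z))$ for $f\in A^2$, $z\in\mathbb{D}$. Isometric means $\|T_{w,\varphi}f\|_{A^2}=\|f\|_{A^2}$ for all $f\in A^2$ (not necessarily surjective). *)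

theory Defs
  imports "HOL-Complex_Analysis.Complex_Analysis"
begin

abbreviation unit_disc :: "complex set"  ("\<bbbD>")
  where "\<bbbD> \<equiv> ball 0 1"

definition disc_measure :: "complex measure"
  where "disc_measure = uniform_measure (lebesgue_on \<bbbD>) \<bbbD>"

text \<open>
  Holomorphic functions on the disc are represented by total functions on the complex plane; their
  values outside the disc play no role, since \<^term>\<open>disc_measure\<close> has the disc as its space.
\<close>

definition bergman_space :: "(complex \<Rightarrow> complex) set"
  where "bergman_space =
    {f. f holomorphic_on \<bbbD> \<and> integrable disc_measure (\<lambda>z. (cmod (f z))\<^sup>2)}"

definition bergman_norm :: "(complex \<Rightarrow> complex) \<Rightarrow> real"
  where "bergman_norm f = sqrt (\<integral>z. (cmod (f z))\<^sup>2 \<partial>disc_measure)"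

definition weighted_comp ::
    "(complex \<Rightarrow> complex) \<Rightarrow> (complex \<Rightarrow> complex) \<Rightarrow> (complex \<Rightarrow> complex) \<Rightarrow> complex \<Rightarrow> complex"
  where "weighted_comp w \<phi> f = (\<lambda>z. w z * f (\<phi> z))"

text \<open>
  The membership of \<open>T f\<close> in the space must be required explicitly: the Bochner integral in
  \<^term>\<open>bergman_norm\<close> is \<open>0\<close> for non-integrable functions.
\<close>

definition bergman_isometric :: "((complex \<Rightarrow> complex) \<Rightarrow> complex \<Rightarrow> complex) \<Rightarrow> bool"
  where "bergman_isometric T \<longleftrightarrow>
    (\<forall>f\<in>bergman_space. T f \<in> bergman_space \<and> bergman_norm (T f) = bergman_norm f)"

end

theory Submission
  imports Defs
begin

text \<open>
  By the area formula, the integral of \<open>g (\<phi> z) * \<bar>\<phi>' z\<bar>\<^sup>2\<close> equals the integral of \<open>g\<close> against the number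
  of preimages under \<open>\<phi>\<close>, which is \<open>N\<close> almost everywhere; take \<open>g = \<bar>f\<bar>\<^sup>2 / N\<close>. Critical points
  contribute nothing on the left, and since \<open>N \<ge> 1\<close> rules out a constant \<open>\<phi>\<close>, the critical values
  are countable, so they do not affect the right-hand side either. The area formula itself reduces, by
  a countable partition into Borel pieces on which \<open>\<phi>\<close> is injective, to the change of variables
  theorem, which the library has only for \<open>real^'n\<close> and which is transported along
  the identification of \<open>complex\<close> with \<open>real^2\<close>.
\<close>

section \<open>Measure-preserving coordinates on the complex plane\<close>

definition vec_of_complex :: "complex \<Rightarrow> real^2" where "vec_of_complex z = vector [Re z, Im z]"
definition complex_of_vec :: "real^2 \<Rightarrow> complex" where "complex_of_vec x = Complex (x $ 1) (x $ 2)"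

lemma vec_of_complex_nth [simp]: "vec_of_complex z $ 1 = Re z" "vec_of_complex z $ 2 = Im z"
  by (simp_all add: vec_of_complex_def)

lemma complex_of_vec_vec_of_complex [simp]: "complex_of_vec (vec_of_complex z) = z"
  by (simp add: complex_of_vec_def)

lemma vec_of_complex_complex_of_vec [simp]: "vec_of_complex (complex_of_vec x) = x"
  by (simp add: vec_eq_iff forall_2 complex_of_vec_def)

lemma bounded_linear_vec_of_complex: "bounded_linear vec_of_complex"
  by (intro linear_conv_bounded_linear[THEN iffD1] linearI) (simp_all add: vec_eq_iff forall_2)

lemma bounded_linear_complex_of_vec: "bounded_linear complex_of_vec"
  by (intro linear_conv_bounded_linear[THEN iffD1] linearI) (simp_all add: complex_of_vec_def complex_eq_iff)

lemma borel_measurable_vec_of_complex [measurable]: "vec_of_complex \<in> borel_measurable borel"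
  by (intro borel_measurable_continuous_onI linear_continuous_on bounded_linear_vec_of_complex)

lemma borel_measurable_complex_of_vec [measurable]: "complex_of_vec \<in> borel_measurable borel"
  by (intro borel_measurable_continuous_onI linear_continuous_on bounded_linear_complex_of_vec)

lemma vec_of_complex_image: "vec_of_complex ` S = complex_of_vec -` S"
  by (auto simp: image_iff) (metis vec_of_complex_complex_of_vec)

text \<open>A Borel measure that gives every box its volume is Lebesgue measure. The preimage of a
  box is the complex box with the same side lengths, so volumes agree.\<close>

lemma distr_lborel_vec_of_complex: "distr lborel borel vec_of_complex = lborel"
proof (rule lborel_eqI[symmetric])
  have B: "(Basis :: (real^2) set) = {axis 1 1, axis 2 1}"
    by (auto simp: Basis_vec_def) (metis exhaust_2)
  have ne: "axis 1 1 \<noteq> (axis 2 1 :: real^2)"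
    by (simp add: axis_eq_axis)
  fix l u :: "real^2"
  assume *: "\<And>b. b \<in> Basis \<Longrightarrow> l \<bullet> b \<le> u \<bullet> b"
  have le: "l $ 1 \<le> u $ 1" "l $ 2 \<le> u $ 2"
    using *[of "axis 1 1"] *[of "axis 2 1"] by (simp_all add: B inner_axis)
  have "vec_of_complex -` box l u = box (complex_of_vec l) (complex_of_vec u)"
    by (auto simp: mem_box B inner_axis Basis_complex_def complex_of_vec_def)
  then show "emeasure (distr lborel borel vec_of_complex) (box l u) = (\<Prod>b\<in>Basis. (u - l) \<bullet> b)"
    using le ne
    by (simp add: emeasure_distr emeasure_lborel_box_eq B Basis_complex_def complex_of_vec_def inner_axis)
qed simp

text \<open>In real coordinates, multiplication by p + iq has rows (p, -q) and (q, p), whose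
  determinant is p^2 + q^2. This turns a complex derivative into a real Jacobian.\<close>

lemma det_vec_of_complex_mult:
  "det (matrix (\<lambda>h. vec_of_complex (a * complex_of_vec h))) = (cmod a)\<^sup>2"
  unfolding cmod_power2 by (simp add: det_2 matrix_def complex_of_vec_def axis_def power2_eq_square)

section \<open>Change of variables for injective holomorphic maps\<close>

lemma borel_measurable_holomorphic_indicator:
  assumes "f holomorphic_on U" "E \<in> sets borel" "E \<subseteq> U"
  shows "(\<lambda>z. indicator E z *\<^sub>R f z) \<in> borel_measurable borel"
  using assms
  by (intro borel_measurable_continuous_on_indicator holomorphic_on_imp_continuous_on)
     (auto intro: holomorphic_on_subset)

lemma borel_measurable_deriv_indicator:
  assumes "\<phi> holomorphic_on U" "open U" "E \<in> sets borel" "E \<subseteq> U"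
  shows "(\<lambda>z. ennreal ((cmod (deriv \<phi> z))\<^sup>2) * indicator E z) \<in> borel_measurable borel"
proof -
  have "(\<lambda>z. indicator E z *\<^sub>R deriv \<phi> z) \<in> borel_measurable borel"
    using assms by (intro borel_measurable_holomorphic_indicator holomorphic_deriv)
  then have "(\<lambda>z. ennreal ((cmod (indicator E z *\<^sub>R deriv \<phi> z))\<^sup>2)) \<in> borel_measurable borel"
    by measurable
  also have "(\<lambda>z. ennreal ((cmod (indicator E z *\<^sub>R deriv \<phi> z))\<^sup>2))
      = (\<lambda>z. ennreal ((cmod (deriv \<phi> z))\<^sup>2) * indicator E z)"
    by (auto simp: indicator_def)
  finally show ?thesis .
qed

lemma emeasure_holomorphic_image:
  assumes hol: "\<phi> holomorphic_on U" and "open U"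
    and E: "E \<in> sets borel" "E \<subseteq> U" and inj: "inj_on \<phi> E"
    and img: "\<phi> ` E \<in> sets borel" and fin: "emeasure lborel (\<phi> ` E) < \<infinity>"
  shows "emeasure lborel (\<phi> ` E) = (\<integral>\<^sup>+z. ennreal ((cmod (deriv \<phi> z))\<^sup>2) * indicator E z \<partial>lborel)"
proof -
  define f where "f x = vec_of_complex (\<phi> (complex_of_vec x))" for x
  define f' where "f' x h = vec_of_complex (deriv \<phi> (complex_of_vec x) * complex_of_vec h)" for x h
  define S where "S = vec_of_complex ` E"
  have S: "S \<in> sets borel"
    unfolding S_def vec_of_complex_image using measurable_sets[OF borel_measurable_complex_of_vec E(1)] by simp
  have fS: "f ` S = complex_of_vec -` (\<phi> ` E)"
    unfolding vec_of_complex_image[symmetric] by (auto simp: f_def S_def image_image)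
  have fS_borel: "f ` S \<in> sets borel"
    unfolding fS using measurable_sets[OF borel_measurable_complex_of_vec img] by simp
  have em: "emeasure lborel (f ` S) = emeasure lborel (\<phi> ` E)"
    using fS_borel by (subst distr_lborel_vec_of_complex[symmetric]) (simp add: emeasure_distr fS vimage_def)
  have "(f has_derivative f' x) (at x within S)" if "x \<in> S" for x
  proof -
    have "(\<phi> has_derivative (*) (deriv \<phi> (complex_of_vec x))) (at (complex_of_vec x))"
      using that E(2) holomorphic_derivI[OF hol \<open>open U\<close>]
      by (auto simp: S_def has_field_derivative_def)
    then have "((\<lambda>x. \<phi> (complex_of_vec x)) has_derivative
        (\<lambda>h. deriv \<phi> (complex_of_vec x) * complex_of_vec h)) (at x within S)"
      using has_derivative_compose[OF bounded_linear_imp_has_derivative[OF bounded_linear_complex_of_vec]]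
      by blast
    from bounded_linear.has_derivative[OF bounded_linear_vec_of_complex this] show ?thesis
      by (simp add: f_def[abs_def] f'_def[abs_def])
  qed
  moreover have "inj_on f S"
    using inj by (auto simp: inj_on_def S_def f_def) (metis complex_of_vec_vec_of_complex)
  moreover have "f ` S \<in> lmeasurable"
    using fS_borel fin em by (intro fmeasurableI) auto
  ultimately have "((\<lambda>x. \<bar>det (matrix (f' x))\<bar>) has_integral measure lebesgue (f ` S)) S"
    using has_measure_differentiable_image[of S f f'] S by auto
  from nn_integral_has_integral_lebesgue'[OF _ this]
  have "(\<integral>\<^sup>+x. ennreal \<bar>det (matrix (f' x))\<bar> * indicator S x \<partial>lborel)
      = ennreal (measure lebesgue (f ` S))"
    by simp
  moreover have "ennreal (measure lebesgue (f ` S)) = emeasure lborel (f ` S)"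
    using fS_borel fin em by (subst emeasure_eq_ennreal_measure) auto
  moreover have "(\<integral>\<^sup>+x. ennreal \<bar>det (matrix (f' x))\<bar> * indicator S x \<partial>lborel)
      = (\<integral>\<^sup>+x. ennreal ((cmod (deriv \<phi> (complex_of_vec x)))\<^sup>2) * indicator E (complex_of_vec x) \<partial>lborel)"
    by (intro nn_integral_cong)
       (auto simp: f'_def[abs_def] det_vec_of_complex_mult S_def vec_of_complex_image indicator_def)
  moreover have "\<dots> = (\<integral>\<^sup>+z. ennreal ((cmod (deriv \<phi> z))\<^sup>2) * indicator E z \<partial>lborel)"
    using borel_measurable_deriv_indicator[OF hol \<open>open U\<close> E]
    by (subst distr_lborel_vec_of_complex[symmetric], subst nn_integral_distr) simp_all
  ultimately show ?thesis
    using em by simp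
qed

text \<open>The formula for images of Borel sets says that two measures coincide, and integrating
  \<open>g\<close> against both gives the claim. Boundedness of the image of \<open>U\<close>
  supplies the finite measure required there.\<close>

lemma nn_integral_holomorphic_image:
  assumes hol: "\<phi> holomorphic_on U" and U: "open U" and inj: "inj_on \<phi> U"
    and bdd: "bounded (\<phi> ` U)" and E: "E \<in> sets borel" "E \<subseteq> U"
    and g: "g \<in> borel_measurable borel"
  shows "\<phi> ` E \<in> sets borel"
    and "(\<integral>\<^sup>+w. g w * indicator (\<phi> ` E) w \<partial>lborel)
      = (\<integral>\<^sup>+z. g (\<phi> z) * ennreal ((cmod (deriv \<phi> z))\<^sup>2) * indicator E z \<partial>lborel)"
proof -
  obtain \<psi> where \<psi>: "\<psi> holomorphic_on (\<phi> ` U)" "\<And>z. z \<in> U \<Longrightarrow> \<psi> (\<phi> z) = z"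
    using holomorphic_has_inverse[OF hol U inj] by metis
  have "open (\<phi> ` U)"
    using open_mapping_thm3[OF hol U inj] .
  \<comment> \<open>Injectivity gives a holomorphic inverse \<open>\<psi>\<close> on the open image,
    so a forward image under \<open>\<phi>\<close> is a preimage under
    \<open>\<psi>\<close>.\<close>
  have img: "\<phi> ` A \<in> sets borel" if A: "A \<in> sets borel" "A \<subseteq> U" for A
  proof -
    have "\<psi> -` A \<inter> \<phi> ` U \<in> sets (restrict_space borel (\<phi> ` U))"
      using measurable_sets[OF borel_measurable_continuous_on_restrict
          [OF holomorphic_on_imp_continuous_on[OF \<psi>(1)]] A(1)]
      by (simp add: space_restrict_space)
    moreover have "\<psi> -` A \<inter> \<phi> ` U = \<phi> ` A"
      using A \<psi>(2) by force
    ultimately show ?thesis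
      using \<open>open (\<phi> ` U)\<close> by (auto simp: sets_restrict_space)
  qed
  show "\<phi> ` E \<in> sets borel"
    by (rule img[OF E])
  have emeasure_img: "emeasure lborel (\<phi> ` A)
      = (\<integral>\<^sup>+z. ennreal ((cmod (deriv \<phi> z))\<^sup>2) * indicator A z \<partial>lborel)"
    if "A \<in> sets borel" "A \<subseteq> U" for A
  proof (rule emeasure_holomorphic_image[OF hol U that])
    show "emeasure lborel (\<phi> ` A) < \<infinity>"
      using that bdd by (intro emeasure_bounded_finite) (meson bounded_subset image_mono)
  qed (use that img inj inj_on_subset in auto)
  \<comment> \<open>\<open>\<phi>\<close> is arbitrary outside \<open>U\<close>, so a Borel map on
    the whole plane is needed for the push-forward. The cut-off is harmless: the density
    \<open>J\<close> vanishes outside \<open>E\<close>, where both maps agree.\<close>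
  define \<phi>\<^sub>0 where "\<phi>\<^sub>0 z = indicator U z *\<^sub>R \<phi> z" for z
  define J where "J z = ennreal ((cmod (deriv \<phi> z))\<^sup>2) * indicator E z" for z
  have [measurable]: "\<phi>\<^sub>0 \<in> borel_measurable borel"
    unfolding \<phi>\<^sub>0_def using U hol by (intro borel_measurable_holomorphic_indicator) auto
  have [measurable]: "J \<in> borel_measurable borel"
    unfolding J_def by (rule borel_measurable_deriv_indicator[OF hol U E])
  note [measurable] = g E(1) \<open>\<phi> ` E \<in> sets borel\<close>
  have "distr (density lborel J) borel \<phi>\<^sub>0 = density lborel (indicator (\<phi> ` E))"
  proof (rule measure_eqI)
    fix A :: "complex set"
    assume "A \<in> sets (distr (density lborel J) borel \<phi>\<^sub>0)"
    then have A [measurable]: "A \<in> sets borel" by simp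
    have meas: "\<phi>\<^sub>0 -` A \<inter> E \<in> sets borel"
      using measurable_sets[OF \<open>\<phi>\<^sub>0 \<in> borel_measurable borel\<close> A] E(1) by auto
    have "emeasure (distr (density lborel J) borel \<phi>\<^sub>0) A = (\<integral>\<^sup>+z. J z * indicator (\<phi>\<^sub>0 -` A) z \<partial>lborel)"
      using measurable_sets[OF \<open>\<phi>\<^sub>0 \<in> borel_measurable borel\<close> A]
      by (simp add: emeasure_distr emeasure_density)
    also have "\<dots> = (\<integral>\<^sup>+z. ennreal ((cmod (deriv \<phi> z))\<^sup>2) * indicator (\<phi>\<^sub>0 -` A \<inter> E) z \<partial>lborel)"
      by (intro nn_integral_cong) (auto simp: J_def indicator_def)
    also have "\<dots> = emeasure lborel (\<phi> ` (\<phi>\<^sub>0 -` A \<inter> E))"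
      using meas E(2) by (intro emeasure_img[symmetric]) auto
    also have "\<phi> ` (\<phi>\<^sub>0 -` A \<inter> E) = \<phi> ` E \<inter> A"
      using E(2) by (auto simp: \<phi>\<^sub>0_def indicator_def)
    also have "emeasure lborel (\<phi> ` E \<inter> A) = emeasure (density lborel (indicator (\<phi> ` E))) A"
      by (simp add: emeasure_density nn_integral_indicator flip: indicator_inter_arith)
    finally show "emeasure (distr (density lborel J) borel \<phi>\<^sub>0) A
        = emeasure (density lborel (indicator (\<phi> ` E))) A" .
  qed simp
  then have "(\<integral>\<^sup>+w. g w \<partial>density lborel (indicator (\<phi> ` E)))
      = (\<integral>\<^sup>+w. g w \<partial>distr (density lborel J) borel \<phi>\<^sub>0)"
    by simp
  also have "\<dots> = (\<integral>\<^sup>+z. J z * g (\<phi>\<^sub>0 z) \<partial>lborel)"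
    by (simp add: nn_integral_distr nn_integral_density)
  also have "\<dots> = (\<integral>\<^sup>+z. g (\<phi> z) * ennreal ((cmod (deriv \<phi> z))\<^sup>2) * indicator E z \<partial>lborel)"
    using E(2) by (intro nn_integral_cong) (auto simp: J_def \<phi>\<^sub>0_def indicator_def mult_ac)
  finally show "(\<integral>\<^sup>+w. g w * indicator (\<phi> ` E) w \<partial>lborel)
      = (\<integral>\<^sup>+z. g (\<phi> z) * ennreal ((cmod (deriv \<phi> z))\<^sup>2) * indicator E z \<partial>lborel)"
    by (simp add: nn_integral_density mult.commute)
qed

section \<open>The area formula with multiplicity\<close>

theorem holomorphic_area_formula:
  assumes hol: "\<phi> holomorphic_on U" and U: "open U"
    and nz: "\<And>z. z \<in> U \<Longrightarrow> deriv \<phi> z \<noteq> 0"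
    and g: "g \<in> borel_measurable borel"
  shows "(\<integral>\<^sup>+z. g (\<phi> z) * ennreal ((cmod (deriv \<phi> z))\<^sup>2) * indicator U z \<partial>lborel)
      = (\<integral>\<^sup>+w. g w * emeasure (count_space UNIV) {z \<in> U. \<phi> z = w} \<partial>lborel)"
proof -
  define \<F> where "\<F> = {V. open V \<and> V \<subseteq> U \<and> inj_on \<phi> V \<and> bounded (\<phi> ` V)}"
  have "\<Union>\<F> = U"
  proof
    show "U \<subseteq> \<Union>\<F>"
    proof
      fix z assume z: "z \<in> U"
      obtain r where r: "r > 0" "ball z r \<subseteq> U" "inj_on \<phi> (ball z r)"
        using has_complex_derivative_locally_injective[OF hol z U nz[OF z]] .
      \<comment> \<open>\<open>\<phi>\<close> is injective on the ball but may be unbounded there;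
        intersecting with the preimage of a unit ball bounds the image.\<close>
      define V where "V = ball z r \<inter> \<phi> -` ball (\<phi> z) 1"
      have "open V"
        unfolding V_def using r(2) hol
        by (intro continuous_open_preimage holomorphic_on_imp_continuous_on)
           (auto intro: holomorphic_on_subset)
      moreover have "bounded (\<phi> ` V)"
        by (rule bounded_subset[OF bounded_ball[of "\<phi> z" 1]]) (auto simp: V_def)
      ultimately have "V \<in> \<F>"
        using r inj_on_subset[OF r(3), of V] by (auto simp: \<F>_def V_def)
      moreover have "z \<in> V"
        using r by (simp add: V_def)
      ultimately show "z \<in> \<Union>\<F>" by blast
    qed
  qed (auto simp: \<F>_def)
  moreover obtain \<G> where \<G>: "\<G> \<subseteq> \<F>" "countable \<G>" "\<Union>\<G> = \<Union>\<F>"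
    using Lindelof[of \<F>] by (auto simp: \<F>_def)
  \<comment> \<open>Inserting the empty set makes the family nonempty, so that
    \<open>from_nat_into\<close> enumerates exactly this family, even if the subcover is
    empty.\<close>
  moreover define V where "V = from_nat_into (insert {} \<G>)"
  ultimately have "range V = insert {} \<G>"
    by (simp add: range_from_nat_into)
  moreover have "{} \<in> \<F>"
    by (simp add: \<F>_def)
  ultimately have V: "(\<Union>n. V n) = U" "range V \<subseteq> \<F>"
    using \<G> \<open>\<Union>\<F> = U\<close> by auto
  have V_mem: "V n \<in> \<F>" for n
    using V(2) by blast
  define E where "E = disjointed V"
  have E: "disjoint_family E" "(\<Union>n. E n) = U" "\<And>n. E n \<subseteq> V n"
    using V(1) by (simp_all add: E_def disjoint_family_disjointed UN_disjointed_eq disjointed_subset)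
  have "range E \<subseteq> sets borel"
    unfolding E_def using V_mem by (intro sets.range_disjointed_sets) (auto simp: \<F>_def)
  then have E_borel [measurable]: "E n \<in> sets borel" for n
    by auto
  have V': "\<phi> holomorphic_on V n" "open (V n)" "inj_on \<phi> (V n)" "bounded (\<phi> ` V n)" for n
    using V_mem[of n] holomorphic_on_subset[OF hol] by (auto simp: \<F>_def)
  note img = nn_integral_holomorphic_image[OF V' E_borel E(3)]
  note [measurable] = g img(1)[OF g]
  have count: "emeasure (count_space UNIV) {z \<in> U. \<phi> z = w} = (\<Sum>n. indicator (\<phi> ` E n) w)" for w
  proof -
    have "{z \<in> U. \<phi> z = w} = (\<Union>n. {z \<in> E n. \<phi> z = w})"
      using E(2) by blast
    also have "emeasure (count_space UNIV) \<dots> = (\<Sum>n. emeasure (count_space UNIV) {z \<in> E n. \<phi> z = w})"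
      using E(1) by (intro suminf_emeasure[symmetric]) (auto simp: disjoint_family_on_def)
    also have "\<dots> = (\<Sum>n. indicator (\<phi> ` E n) w)"
    proof (intro suminf_cong)
      fix n
      show "emeasure (count_space UNIV) {z \<in> E n. \<phi> z = w} = indicator (\<phi> ` E n) w"
      proof (cases "w \<in> \<phi> ` E n")
        case True
        then obtain z where z: "z \<in> E n" "\<phi> z = w" by blast
        then have "{z \<in> E n. \<phi> z = w} = {z}"
          using inj_onD[OF V'(3)] E(3) by blast
        with True show ?thesis by simp
      next
        case False
        then have empty: "{z \<in> E n. \<phi> z = w} = {}" by blast
        show ?thesis
          unfolding empty using False by simp
      qed
    qed
    finally show ?thesis .
  qed
  have split: "indicator U z = (\<Sum>n. indicator (E n) z :: ennreal)" for z
    using suminf_indicator[OF E(1), of z] E(2) by simp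
  \<comment> \<open>Since \<open>\<phi>\<close> and its derivative are controlled only on
    \<open>U\<close>, each is cut off to \<open>E n\<close> separately; the product is unchanged
    because its second factor vanishes outside \<open>E n\<close>.\<close>
  have J [measurable]: "(\<lambda>z. g (\<phi> z) * ennreal ((cmod (deriv \<phi> z))\<^sup>2) * indicator (E n) z)
      \<in> borel_measurable borel" for n
  proof -
    have "E n \<subseteq> U" using E(2) by blast
    note [measurable] = borel_measurable_holomorphic_indicator[OF hol E_borel this]
      borel_measurable_deriv_indicator[OF hol U E_borel this]
    have "(\<lambda>z. g (indicator (E n) z *\<^sub>R \<phi> z) * (ennreal ((cmod (deriv \<phi> z))\<^sup>2) * indicator (E n) z))
        \<in> borel_measurable borel"
      by measurable
    also have "(\<lambda>z. g (indicator (E n) z *\<^sub>R \<phi> z) * (ennreal ((cmod (deriv \<phi> z))\<^sup>2) * indicator (E n) z))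
        = (\<lambda>z. g (\<phi> z) * ennreal ((cmod (deriv \<phi> z))\<^sup>2) * indicator (E n) z)"
      by (auto simp: indicator_def)
    finally show ?thesis .
  qed
  have "(\<integral>\<^sup>+z. g (\<phi> z) * ennreal ((cmod (deriv \<phi> z))\<^sup>2) * indicator U z \<partial>lborel)
      = (\<integral>\<^sup>+z. (\<Sum>n. g (\<phi> z) * ennreal ((cmod (deriv \<phi> z))\<^sup>2) * indicator (E n) z) \<partial>lborel)"
    by (simp add: split)
  also have "\<dots> = (\<Sum>n. \<integral>\<^sup>+z. g (\<phi> z) * ennreal ((cmod (deriv \<phi> z))\<^sup>2) * indicator (E n) z \<partial>lborel)"
    by (intro nn_integral_suminf) simp
  also have "\<dots> = (\<Sum>n. \<integral>\<^sup>+w. g w * indicator (\<phi> ` E n) w \<partial>lborel)"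
    by (simp add: img(2)[OF g])
  also have "\<dots> = (\<integral>\<^sup>+w. (\<Sum>n. g w * indicator (\<phi> ` E n) w) \<partial>lborel)"
    by (intro nn_integral_suminf[symmetric]) simp
  finally show ?thesis
    by (simp add: count)
qed

section \<open>The Bergman space through nonnegative integrals\<close>

lemma borel_measurable_square_norm_indicator:
  assumes "f holomorphic_on \<bbbD>"
  shows "(\<lambda>z. ennreal ((cmod (f z))\<^sup>2) * indicator \<bbbD> z) \<in> borel_measurable borel"
proof -
  have "(\<lambda>z. ennreal ((cmod (indicator \<bbbD> z *\<^sub>R f z))\<^sup>2)) \<in> borel_measurable borel"
    using borel_measurable_holomorphic_indicator[OF assms, of \<bbbD>] by measurable
  also have "(\<lambda>z. ennreal ((cmod (indicator \<bbbD> z *\<^sub>R f z))\<^sup>2))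
      = (\<lambda>z. ennreal ((cmod (f z))\<^sup>2) * indicator \<bbbD> z)"
    by (auto simp: indicator_def)
  finally show ?thesis .
qed

lemma emeasure_lebesgue_on_disc:
  "emeasure (lebesgue_on \<bbbD>) \<bbbD> = emeasure lborel \<bbbD>"
  "emeasure lborel \<bbbD> \<noteq> 0" "emeasure lborel \<bbbD> < \<infinity>"
proof -
  show "emeasure (lebesgue_on \<bbbD>) \<bbbD> = emeasure lborel \<bbbD>"
    by (simp add: emeasure_restrict_space)
  show "emeasure lborel \<bbbD> < \<infinity>"
    by (intro emeasure_bounded_finite) auto
  show "emeasure lborel \<bbbD> \<noteq> 0"
    using content_ball_pos[of 1 "0::complex"] by (auto simp: measure_def)
qed

text \<open>Neither completion nor division by the finite nonzero area of the disc changes which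
  properties hold almost everywhere.\<close>

lemma AE_disc_measure_iff:
  "(AE z in disc_measure. P z) \<longleftrightarrow> (AE z in lborel. z \<in> \<bbbD> \<longrightarrow> P z)"
  unfolding disc_measure_def using emeasure_lebesgue_on_disc
  by (subst AE_uniform_measure) (simp_all add: AE_restrict_space_iff AE_completion_iff imp_conjL)

lemma square_norm_measurable_disc:
  assumes "f holomorphic_on \<bbbD>"
  shows "(\<lambda>z. (cmod (f z))\<^sup>2) \<in> borel_measurable (lebesgue_on \<bbbD>)"
  using assms
  by (intro continuous_imp_measurable_on_sets_lebesgue continuous_intros
      holomorphic_on_imp_continuous_on) auto

lemma nn_integral_disc_measure:
  assumes "f holomorphic_on \<bbbD>"
  shows "(\<integral>\<^sup>+z. ennreal ((cmod (f z))\<^sup>2) \<partial>disc_measure)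
    = (\<integral>\<^sup>+z. ennreal ((cmod (f z))\<^sup>2) * indicator \<bbbD> z \<partial>lborel) / emeasure lborel \<bbbD>"
proof -
  have "(\<lambda>z. ennreal ((cmod (f z))\<^sup>2)) \<in> borel_measurable (lebesgue_on \<bbbD>)"
    using square_norm_measurable_disc[OF assms] by measurable
  moreover have "\<bbbD> \<in> sets (lebesgue_on \<bbbD>)"
    by (simp add: sets_restrict_space_iff)
  \<comment> \<open>One indicator comes from the uniform measure, the other from restricting
    Lebesgue measure to the disc.\<close>
  moreover have "indicator \<bbbD> z * indicator \<bbbD> z = (indicator \<bbbD> z :: ennreal)" for z :: complex
    by (simp add: indicator_def)
  ultimately show ?thesis
    unfolding disc_measure_def
    by (simp add: nn_integral_uniform_measure nn_integral_restrict_space nn_integral_completion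
        emeasure_lebesgue_on_disc(1) mult.assoc)
qed

text \<open>Holomorphy provides measurability, so only finiteness remains. Membership and norm are
  thus read off the same nonnegative integral, and preserving it settles both.\<close>

lemma bergman_space_iff_nn_integral:
  assumes "f holomorphic_on \<bbbD>"
  shows "f \<in> bergman_space \<longleftrightarrow> (\<integral>\<^sup>+z. ennreal ((cmod (f z))\<^sup>2) \<partial>disc_measure) < \<infinity>"
  using assms square_norm_measurable_disc[OF assms]
  by (simp add: bergman_space_def integrable_iff_bounded disc_measure_def)

lemma bergman_norm_nn_integral:
  assumes "f holomorphic_on \<bbbD>"
  shows "bergman_norm f = sqrt (enn2real (\<integral>\<^sup>+z. ennreal ((cmod (f z))\<^sup>2) \<partial>disc_measure))"
  unfolding bergman_norm_def using square_norm_measurable_disc[OF assms]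
  by (subst integral_eq_nn_integral) (auto simp: disc_measure_def)

section \<open>Critical points of nonconstant holomorphic functions\<close>

lemma open_imp_fsigma:
  fixes S :: "'a::euclidean_space set"
  assumes "open S"
  shows "fsigma S"
proof -
  obtain C :: "nat \<Rightarrow> 'a set" where "\<And>n. compact (C n)" "(\<Union>n. C n) = S"
    using open_Union_compact_subsets[OF assms] by metis
  then show ?thesis
    using fsigma.intros[of C] by (auto simp: compact_imp_closed)
qed

text \<open>By the identity theorem, a derivative with uncountably many zeros in a connected open
  set vanishes identically, which makes the function constant.\<close>

lemma countable_critical_points:
  assumes hol: "\<phi> holomorphic_on S" and S: "open S" "connected S"
    and nc: "\<not> \<phi> constant_on S"
  shows "countable {z \<in> S. deriv \<phi> z = 0}"
proof (rule ccontr)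
  assume "uncountable {z \<in> S. deriv \<phi> z = 0}"
  then have "S \<subseteq> {z \<in> S. deriv \<phi> z = 0}"
    using S hol
    by (intro holomorphic_countable_equal holomorphic_deriv holomorphic_on_const open_imp_fsigma)
  then have "(\<phi> has_field_derivative 0) (at z)" if "z \<in> S" for z
    using that holomorphic_derivI[OF hol S(1) that] by auto
  then have "\<phi> constant_on S"
    using S hol
    by (intro DERIV_zero_connected_constant_on[where K = "{}"] holomorphic_on_imp_continuous_on) auto
  with nc show False ..
qed

section \<open>The isometry\<close>

theorem proposition4p5:
  fixes \<phi> :: "complex \<Rightarrow> complex" and N :: nat and c :: complex
  assumes "\<phi> holomorphic_on \<bbbD>" and "\<phi> ` \<bbbD> \<subseteq> \<bbbD>"
    and "N \<ge> 1"
    and "\<bbbD> - {z \<in> \<bbbD>. finite {\<zeta> \<in> \<bbbD>. \<phi> \<zeta> = z} \<and> card {\<zeta> \<in> \<bbbD>. \<phi> \<zeta> = z} = N}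
           \<in> null_sets disc_measure"
    and "cmod c = 1"
  shows "bergman_isometric
           (weighted_comp (\<lambda>z. c * deriv \<phi> z / complex_of_real (sqrt (real N))) \<phi>)"
proof -
  define F where "F w = {\<zeta> \<in> \<bbbD>. \<phi> \<zeta> = w}" for w
  have fibre: "AE w in lborel. w \<in> \<bbbD> \<longrightarrow> finite (F w) \<and> card (F w) = N"
    using AE_not_in[OF assms(4)] unfolding AE_disc_measure_iff F_def by eventually_elim auto
  \<comment> \<open>A constant map has empty fibres over all points but one. As almost every fibre
    over the disc has \<open>N \<ge> 1\<close> points, the disc would be a null set.\<close>
  have "\<not> \<phi> constant_on \<bbbD>"
  proof
    assume "\<phi> constant_on \<bbbD>"
    then obtain a where a: "\<And>z. z \<in> \<bbbD> \<Longrightarrow> \<phi> z = a"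
      by (auto simp: constant_on_def)
    have "AE w in lborel. w \<noteq> a"
      by (rule AE_lborel_singleton)
    with fibre have "AE w in lborel. w \<notin> \<bbbD>"
    proof eventually_elim
      case (elim w)
      then have "F w = {}"
        using a by (auto simp: F_def)
      with elim \<open>N \<ge> 1\<close> show ?case by auto
    qed
    then have "\<bbbD> \<in> null_sets lborel"
      by (subst AE_iff_null_sets) auto
    then have "emeasure lborel \<bbbD> = 0" ..
    with emeasure_lebesgue_on_disc(2) show False ..
  qed
  define C where "C = {z \<in> \<bbbD>. deriv \<phi> z = 0}"
  define U where "U = {z \<in> \<bbbD>. deriv \<phi> z \<noteq> 0}"
  have "countable (\<phi> ` C)"
    unfolding C_def using \<open>\<not> \<phi> constant_on \<bbbD>\<close> assms(1)
    by (intro countable_image countable_critical_points) auto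
  then have "AE w in lborel. w \<notin> \<phi> ` C"
    by (intro AE_not_in countable_imp_null_set_lborel)
  \<comment> \<open>Away from the null set of critical values, every preimage of \<open>w\<close> is
    a regular point, so passing from the disc to \<open>U\<close> loses none.\<close>
  with fibre have count: "AE w in lborel. w \<in> \<bbbD> \<longrightarrow>
      emeasure (count_space UNIV) {z \<in> U. \<phi> z = w} = ennreal (real N)"
  proof eventually_elim
    case (elim w)
    then have "{z \<in> U. \<phi> z = w} = F w"
      by (auto simp: U_def C_def F_def)
    with elim show ?case
      by (simp add: ennreal_of_nat_eq_real_of_nat)
  qed
  have hol': "deriv \<phi> holomorphic_on \<bbbD>"
    using assms(1) by (simp add: holomorphic_deriv)
  have "open (\<bbbD> \<inter> deriv \<phi> -` (- {0}))"
    using hol' by (intro continuous_open_preimage holomorphic_on_imp_continuous_on) auto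
  also have "\<bbbD> \<inter> deriv \<phi> -` (- {0}) = U"
    by (auto simp: U_def)
  finally have U: "open U" .
  define T where "T = weighted_comp (\<lambda>z. c * deriv \<phi> z / complex_of_real (sqrt (real N))) \<phi>"
  have holT: "T f holomorphic_on \<bbbD>" if "f holomorphic_on \<bbbD>" for f
  proof -
    have "(\<lambda>z. f (\<phi> z)) holomorphic_on \<bbbD>"
      using holomorphic_on_compose_gen[OF assms(1) that assms(2)] by (simp add: o_def)
    then show ?thesis
      unfolding T_def weighted_comp_def using assms(1) hol' \<open>N \<ge> 1\<close> by (intro holomorphic_intros) auto
  qed
  have isom: "(\<integral>\<^sup>+z. ennreal ((cmod (T f z))\<^sup>2) * indicator \<bbbD> z \<partial>lborel)
      = (\<integral>\<^sup>+z. ennreal ((cmod (f z))\<^sup>2) * indicator \<bbbD> z \<partial>lborel)"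
    if f: "f holomorphic_on \<bbbD>" for f
  proof -
    \<comment> \<open>The factor 1/N is the squared modulus of the constant in the weight. The
      indicator makes \<open>g\<close> Borel on the plane and zero where the fibre count is
      unknown.\<close>
    define g where "g w = ennreal ((cmod (f w))\<^sup>2) * indicator \<bbbD> w * ennreal (1 / real N)" for w
    have g: "g \<in> borel_measurable borel"
      using borel_measurable_square_norm_indicator[OF f] unfolding g_def by measurable
    have "(\<integral>\<^sup>+z. ennreal ((cmod (T f z))\<^sup>2) * indicator \<bbbD> z \<partial>lborel)
        = (\<integral>\<^sup>+z. g (\<phi> z) * ennreal ((cmod (deriv \<phi> z))\<^sup>2) * indicator U z \<partial>lborel)"
    proof (intro nn_integral_cong)
      fix z
      show "ennreal ((cmod (T f z))\<^sup>2) * indicator \<bbbD> z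
          = g (\<phi> z) * ennreal ((cmod (deriv \<phi> z))\<^sup>2) * indicator U z"
      proof (cases "z \<in> U")
        case True
        then have "z \<in> \<bbbD>"
          by (simp add: U_def)
        moreover from this have "\<phi> z \<in> \<bbbD>"
          using assms(2) by blast
        moreover have "(cmod (T f z))\<^sup>2 = (cmod (f (\<phi> z)))\<^sup>2 * (1 / real N) * (cmod (deriv \<phi> z))\<^sup>2"
          using \<open>cmod c = 1\<close>
          by (simp add: T_def weighted_comp_def norm_mult norm_divide power_mult_distrib power_divide)
        ultimately show ?thesis
          using True by (simp add: g_def mult_ac flip: ennreal_mult)
      \<comment> \<open>A point outside \<open>U\<close> lies outside the disc or is critical; at a
        critical point the weight itself vanishes.\<close>
      qed (auto simp: U_def T_def weighted_comp_def indicator_def)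
    qed
    also have "\<dots> = (\<integral>\<^sup>+w. g w * emeasure (count_space UNIV) {z \<in> U. \<phi> z = w} \<partial>lborel)"
      using assms(1) by (intro holomorphic_area_formula U g) (auto simp: U_def intro: holomorphic_on_subset)
    also have "\<dots> = (\<integral>\<^sup>+w. ennreal ((cmod (f w))\<^sup>2) * indicator \<bbbD> w \<partial>lborel)"
    proof (intro nn_integral_cong_AE, use count in eventually_elim)
      case (elim w)
      have "ennreal (1 / real N) * ennreal (real N) = 1"
        using \<open>N \<ge> 1\<close> by (simp flip: ennreal_mult)
      with elim show ?case
        by (auto simp: g_def indicator_def mult.assoc)
    qed
    finally show ?thesis .
  qed
  show ?thesis
    unfolding bergman_isometric_def T_def[symmetric]
  proof
    fix f assume f: "f \<in> bergman_space"
    then have hf: "f holomorphic_on \<bbbD>"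
      by (simp add: bergman_space_def)
    have "(\<integral>\<^sup>+z. ennreal ((cmod (T f z))\<^sup>2) \<partial>disc_measure)
        = (\<integral>\<^sup>+z. ennreal ((cmod (f z))\<^sup>2) \<partial>disc_measure)"
      using hf holT by (simp add: nn_integral_disc_measure isom)
    with f show "T f \<in> bergman_space \<and> bergman_norm (T f) = bergman_norm f"
      using hf holT[OF hf] by (simp add: bergman_space_iff_nn_integral bergman_norm_nn_integral)
  qed
qed

end
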